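(* Let $(X,d)$ be a Polish space, let $(\Omega,\mathcal{F},\mathbb{P},\theta,\varphi)$ be a pullback continuous (continuous-time) random dynamical system on $X$, and let $A$ be the pullback attractor of $\varphi$. Then there exists $\hat{\Omega}\in\mathcal{F}$ with $\mathbb{P}(\hat{\Omega})=1$ such that for every $\omega\in\hat{\Omega}$ and every compact set $K\subset X$, $$\lim_{t\to\infty}\sup_{x\in K}d(\varphi_t(\theta_{-t}\omega,x),A(\omega))=0.$$
   Context: Polish space means separable complete metric space $(X,d)$, with Borel $\sigma$-algebra $\mathcal{B}(X)$. (No connectedness of $X$ is assumed.) A metric dynamical system $(\Omega,\mathcal{F},\mathbb{P},\theta)$ is a probability space $(\Omega,\mathcal{F},\mathbb{P})$ with a group $(\theta_t)_{t\in\mathbb{R}}$ of maps $\Omega\to\Omega$ such that $(t,\omega)\mapsto\theta_t\omega$ is jointly measurable, $\theta_0=\mathrm{id}$, $\theta_{s+t}=\theta_s\circ\theta_t$, and $\mathbb{P}$ is invariant under every $\theta_t$. A random dynamical system (RDS) $(\Omega,\mathcal{F},\mathbb{P},\theta,\varphi)$ on $X$ is a metric dynamical system together with a jointly measurable map $\varphi:\mathbb{R}_+\times\Omega\times X\to X$, $(t,\omega,x)\mapsto\varphi_t(\omega,x)$, such that for all $s,t\in\mathbb{R}_+$, $\omega\in\Omega$, $x\in X$: $\varphi_0(\omega,x)=x$; $\varphi_{s+t}(\omega,x)=\varphi_t(\theta_s\omega,\varphi_s(\omega,x))$; and $x\mapsto\varphi_t(\omega,x)$ is continuous. The RDS is pullback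 continuous if $t\mapsto\varphi_t(\theta_{-t}\omega,x)$ is continuous on $\mathbb{R}_+$ for each $\omega\in\Omega$ and $x\in X$. For nonempty $A\subset X$, $d(x,A):=\inf_{a\in A}d(x,a)$. A random compact set is a family $\{A(\omega)\}_{\omega\in\Omega}$ of nonempty subsets of $X$ such that $A(\omega)$ is compact for $\mathbb{P}$-almost every $\omega$ and $\omega\mapsto d(x,A(\omega))$ is $\mathcal{F}$-measurable for each $x\in X$. It is $\varphi$-invariant if for every $t\in\mathbb{R}_+$, $\varphi_t(\omega,A(\omega))=A(\theta_t\omega)$ for $\mathbb{P}$-almost every $\omega$. A pullback attractor of the RDS is a random compact set $A$ that is $\varphi$-invariant and such that for every (deterministic) compact set $B\subset X$, $\lim_{t\to\infty}\sup_{x\in B}d(\varphi_t(\theta_{-t}\omega,x),A(\omega))=0$ for $\mathbb{P}$-almost every $\omega$ (the exceptional nullset may depend on $B$). Pullback attractors are almost surely unique. *)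

theory Defs
  imports "HOL-Probability.Probability"
begin

locale metric_dynamical_system = prob_space P
  for P :: "'w measure" +
  fixes \<theta> :: "real \<Rightarrow> 'w \<Rightarrow> 'w"
  assumes flow_measurable: "(\<lambda>(t, \<omega>). \<theta> t \<omega>) \<in> borel \<Otimes>\<^sub>M P \<rightarrow>\<^sub>M P"
    and flow_zero: "\<And>\<omega>. \<omega> \<in> space P \<Longrightarrow> \<theta> 0 \<omega> = \<omega>"
    and flow_add: "\<And>s t \<omega>. \<omega> \<in> space P \<Longrightarrow> \<theta> (s + t) \<omega> = \<theta> s (\<theta> t \<omega>)"
    and flow_invariant: "\<And>t. distr P P (\<theta> t) = P"

(* \<phi> is a total function of real time; only its values at times t \<ge> 0 are constrained. *)
locale random_dynamical_system = metric_dynamical_system P \<theta>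
  for P :: "'w measure" and \<theta> :: "real \<Rightarrow> 'w \<Rightarrow> 'w" +
  fixes \<phi> :: "real \<Rightarrow> 'w \<Rightarrow> 'x::polish_space \<Rightarrow> 'x"
  assumes cocycle_measurable:
      "(\<lambda>(t, \<omega>, x). \<phi> t \<omega> x) \<in> restrict_space borel {0..} \<Otimes>\<^sub>M (P \<Otimes>\<^sub>M borel) \<rightarrow>\<^sub>M borel"
    and cocycle_zero: "\<And>\<omega> x. \<omega> \<in> space P \<Longrightarrow> \<phi> 0 \<omega> x = x"
    and cocycle_add: "\<And>s t \<omega> x. 0 \<le> s \<Longrightarrow> 0 \<le> t \<Longrightarrow> \<omega> \<in> space P \<Longrightarrow>
      \<phi> (s + t) \<omega> x = \<phi> t (\<theta> s \<omega>) (\<phi> s \<omega> x)"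
    and cocycle_continuous: "\<And>t \<omega>. 0 \<le> t \<Longrightarrow> \<omega> \<in> space P \<Longrightarrow> continuous_on UNIV (\<phi> t \<omega>)"

definition pullback_continuous ::
  "'w measure \<Rightarrow> (real \<Rightarrow> 'w \<Rightarrow> 'w) \<Rightarrow> (real \<Rightarrow> 'w \<Rightarrow> 'x \<Rightarrow> 'x::polish_space) \<Rightarrow> bool" where
  "pullback_continuous P \<theta> \<phi> \<longleftrightarrow>
     (\<forall>\<omega>\<in>space P. \<forall>x. continuous_on {0..} (\<lambda>t. \<phi> t (\<theta> (- t) \<omega>) x))"

definition random_compact_set :: "'w measure \<Rightarrow> ('w \<Rightarrow> 'x::polish_space set) \<Rightarrow> bool" where
  "random_compact_set P A \<longleftrightarrow>
     (\<forall>\<omega>\<in>space P. A \<omega> \<noteq> {}) \<and>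
     (AE \<omega> in P. compact (A \<omega>)) \<and>
     (\<forall>x. (\<lambda>\<omega>. infdist x (A \<omega>)) \<in> borel_measurable P)"

definition cocycle_invariant ::
  "'w measure \<Rightarrow> (real \<Rightarrow> 'w \<Rightarrow> 'w) \<Rightarrow> (real \<Rightarrow> 'w \<Rightarrow> 'x \<Rightarrow> 'x::polish_space) \<Rightarrow> ('w \<Rightarrow> 'x set) \<Rightarrow> bool" where
  "cocycle_invariant P \<theta> \<phi> A \<longleftrightarrow> (\<forall>t\<ge>0. AE \<omega> in P. \<phi> t \<omega> ` A \<omega> = A (\<theta> t \<omega>))"

(* The supremum is taken in [0, \<infinity>], so that it is 0 for B = {}; a supremum of reals
   would be an unspecified number there. *)
definition pullback_attracts_at ::
  "(real \<Rightarrow> 'w \<Rightarrow> 'w) \<Rightarrow> (real \<Rightarrow> 'w \<Rightarrow> 'x \<Rightarrow> 'x::polish_space) \<Rightarrow> ('w \<Rightarrow> 'x set) \<Rightarrow> 'w \<Rightarrow> 'x set \<Rightarrow> bool" where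
  "pullback_attracts_at \<theta> \<phi> A \<omega> B \<longleftrightarrow>
     ((\<lambda>t. SUP x\<in>B. ennreal (infdist (\<phi> t (\<theta> (- t) \<omega>) x) (A \<omega>))) \<longlongrightarrow> 0) at_top"

definition pullback_attractor ::
  "'w measure \<Rightarrow> (real \<Rightarrow> 'w \<Rightarrow> 'w) \<Rightarrow> (real \<Rightarrow> 'w \<Rightarrow> 'x \<Rightarrow> 'x::polish_space) \<Rightarrow> ('w \<Rightarrow> 'x set) \<Rightarrow> bool" where
  "pullback_attractor P \<theta> \<phi> A \<longleftrightarrow>
     random_compact_set P A \<and> cocycle_invariant P \<theta> \<phi> A \<and>
     (\<forall>B. compact B \<longrightarrow> (AE \<omega> in P. pullback_attracts_at \<theta> \<phi> A \<omega> B))"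

end

theory Submission
  imports Defs
begin

text \<open>
  If attraction of some compact set fails at \<open>\<omega>\<close>, then by sequential compactness there are a point
  \<open>x \<omega>\<close>, points \<open>y \<rightarrow> x \<omega>\<close> and times \<open>t \<rightarrow> \<infinity>\<close> at which the trajectory is \<open>\<epsilon>\<close>-far from \<open>A \<omega>\<close>; by
  continuity in space and pullback continuity in time, \<open>y\<close> and \<open>t\<close> may be taken from countable dense
  sets. Suppose that such \<open>\<omega>\<close> form a set of positive outer measure. Outer measure is continuous along
  arbitrary increasing unions, so the arbitrary (not necessarily measurable) map \<open>x\<close> is tight: it may
  be confined to a finite union of \<open>1/k\<close>-balls for each \<open>k\<close>. Finitely many points \<open>y\<close> near this set
  then witness the failure after time \<open>k\<close> on a set of measure bounded below, and the union of these
  finite sets over all \<open>k\<close> is relatively compact. Its closure is a deterministic compact set that is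
  not attracted with positive probability.
\<close>

section \<open>Outer measure, and compact sets assembled from finite sets\<close>

text \<open>The finite partial unions increase to the whole union, and outer measure is continuous
  along increasing sequences of arbitrary sets, so the \<open>A y\<close> need not be measurable. It
  serves twice: to confine a map to finitely many balls, and to select finitely many
  witnesses.\<close>

lemma less_outer_measure_of_UN_countable:
  assumes "countable Y" and A: "\<And>y. y \<in> Y \<Longrightarrow> A y \<subseteq> space M"
    and less: "c < outer_measure_of M (\<Union>y\<in>Y. A y)"
  shows "\<exists>H\<subseteq>Y. finite H \<and> c < outer_measure_of M (\<Union>y\<in>H. A y)"
proof (cases "Y = {}")
  case True
  with less show ?thesis by auto
next
  case False
  define e where "e = from_nat_into Y"
  have Y: "Y = range e"
    using False \<open>countable Y\<close> by (simp add: e_def range_from_nat_into)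
  define B where "B n = (\<Union>y\<in>e ` {..n}. A y)" for n
  have "B n \<subseteq> space M" for n
    using A by (auto simp: B_def Y)
  moreover have "incseq B"
    by (force simp: incseq_def B_def)
  moreover have "(\<Union>n. B n) = (\<Union>y\<in>Y. A y)"
    by (auto simp: B_def Y)
  ultimately have "c < (SUP n. outer_measure_of M (B n))"
    using less by (simp add: SUP_outer_measure_of_incseq)
  then obtain n where "c < outer_measure_of M (B n)"
    by (auto simp: less_SUP_iff)
  then show ?thesis
    by (intro exI[of _ "e ` {..n}"]) (auto simp: B_def Y)
qed

text \<open>Total boundedness: given \<open>e\<close>, the centres \<open>F j\<close> take care of
  every \<open>H k\<close> with \<open>k > j\<close>, and the finitely many remaining points serve
  as their own centres. Finitely many closed balls have a closed union, so the cover passes to the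
  closure.\<close>

lemma compact_closure_UN_finite:
  fixes H :: "nat \<Rightarrow> 'x::complete_space set"
  assumes H: "\<And>k. finite (H k)" and F: "\<And>k. finite (F k)"
    and cover: "\<And>j k. j < k \<Longrightarrow> H k \<subseteq> (\<Union>q\<in>F j. ball q (1 / Suc j))"
  shows "compact (closure (\<Union>k. H k))"
  unfolding compact_eq_totally_bounded
proof (intro conjI allI impI)
  fix e :: real
  assume "0 < e"
  then obtain j where j: "1 / Suc j < e"
    using nat_approx_posE by auto
  define Z where "Z = F j \<union> (\<Union>k\<le>j. H k)"
  have "finite Z"
    using H F by (simp add: Z_def)
  have "H k \<subseteq> (\<Union>q\<in>Z. cball q (1 / Suc j))" for k
  proof (cases "j < k")
    case True
    with cover[OF this] show ?thesis
      by (fastforce simp: Z_def)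
  next
    case False
    then show ?thesis
      by (force simp: Z_def)
  qed
  then have "closure (\<Union>k. H k) \<subseteq> (\<Union>q\<in>Z. cball q (1 / Suc j))"
    using \<open>finite Z\<close> by (intro closure_minimal closed_UN) auto
  also have "\<dots> \<subseteq> (\<Union>q\<in>Z. ball q e)"
    using j by fastforce
  finally show "\<exists>Z. finite Z \<and> closure (\<Union>k. H k) \<subseteq> (\<Union>q\<in>Z. ball q e)"
    using \<open>finite Z\<close> by blast
qed (simp add: complete_eq_closed)

text \<open>The measure-theoretic core, free of dynamics. In the application \<open>U k y\<close> is
  the event that the trajectory of \<open>y\<close> is far from the attractor at some rational time
  at or after \<open>k\<close>. Neither \<open>N\<close> nor \<open>x\<close> is assumed
  measurable.\<close>

lemma (in finite_measure) outer_measure_of_eq_0_if_eventually_avoids_compact: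
  fixes U :: "nat \<Rightarrow> 'x::polish_space \<Rightarrow> 'a set"
  assumes "countable D" and D: "\<And>V. open V \<Longrightarrow> V \<noteq> {} \<Longrightarrow> \<exists>d\<in>D. d \<in> V"
    and U: "\<And>k y. y \<in> D \<Longrightarrow> U k y \<in> sets M"
    and avoid: "\<And>B. compact B \<Longrightarrow>
      AE \<omega> in M. \<forall>\<^sub>F k in sequentially. \<forall>y\<in>B \<inter> D. \<omega> \<notin> U k y"
    and "N \<subseteq> space M"
    and x: "\<And>\<omega> k V. \<omega> \<in> N \<Longrightarrow> open V \<Longrightarrow> x \<omega> \<in> V \<Longrightarrow> \<exists>y\<in>V \<inter> D. \<omega> \<in> U k y"
  shows "outer_measure_of M N = 0"
proof (rule ccontr)
  assume "outer_measure_of M N \<noteq> 0"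
  then obtain c where c: "0 < c" "c < outer_measure_of M N"
    using dense[of 0 "outer_measure_of M N"] by (auto simp: zero_less_iff_neq_zero)
  \<comment> \<open>The same bound \<open>c\<close> survives every step: a strict inequality for a
    countable union passes to a finite subunion with no loss.\<close>
  have "\<exists>S. \<forall>k. (S k \<subseteq> N \<and> c < outer_measure_of M (S k)) \<and>
      (S (Suc k) \<subseteq> S k \<and> (\<exists>F. finite F \<and> x ` S (Suc k) \<subseteq> (\<Union>q\<in>F. ball q (1 / Suc k))))"
  proof (rule dependent_nat_choice)
    show "\<exists>S. S \<subseteq> N \<and> c < outer_measure_of M S"
      using c by blast
  next
    fix S k
    assume S: "S \<subseteq> N \<and> c < outer_measure_of M S"
    have "S = (\<Union>q\<in>D. S \<inter> x -` ball q (1 / Suc k))"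
    proof -
      have "\<exists>q\<in>D. x \<omega> \<in> ball q (1 / Suc k)" for \<omega>
        using D[of "ball (x \<omega>) (1 / Suc k)"] by (auto simp: dist_commute)
      then show ?thesis by blast
    qed
    with S have "c < outer_measure_of M (\<Union>q\<in>D. S \<inter> x -` ball q (1 / Suc k))"
      by simp
    then obtain F where "finite F" "c < outer_measure_of M (\<Union>q\<in>F. S \<inter> x -` ball q (1 / Suc k))"
      using less_outer_measure_of_UN_countable[OF \<open>countable D\<close>,
          of "\<lambda>q. S \<inter> x -` ball q (1 / Suc k)" M c] S \<open>N \<subseteq> space M\<close> by blast
    then show "\<exists>S'. (S' \<subseteq> N \<and> c < outer_measure_of M S') \<and>
        (S' \<subseteq> S \<and> (\<exists>F. finite F \<and> x ` S' \<subseteq> (\<Union>q\<in>F. ball q (1 / Suc k))))"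
      using S by (intro exI[of _ "\<Union>q\<in>F. S \<inter> x -` ball q (1 / Suc k)"]) blast
  qed
  then obtain S F where S: "\<And>k. S k \<subseteq> N" "\<And>k. c < outer_measure_of M (S k)"
      "\<And>k. S (Suc k) \<subseteq> S k"
    and F: "\<And>k. finite (F k)" "\<And>k. x ` S (Suc k) \<subseteq> (\<Union>q\<in>F k. ball q (1 / Suc k))"
    by metis
  have "decseq S"
    using S(3) by (rule decseq_SucI)
  define G where "G k = (\<Inter>j<k. \<Union>q\<in>F j. ball q (1 / Suc j))" for k :: nat
  have "open (G k)" for k
    by (auto simp: G_def)
  have xG: "x ` S k \<subseteq> G k" for k
  proof -
    have "x ` S k \<subseteq> (\<Union>q\<in>F j. ball q (1 / Suc j))" if "j < k" for j
      using F(2)[of j] decseqD[OF \<open>decseq S\<close>, of "Suc j" k] that by (meson Suc_leI image_mono order_trans)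
    then show ?thesis
      unfolding G_def by blast
  qed
  have "\<exists>H\<subseteq>G k \<inter> D. finite H \<and> c < outer_measure_of M (\<Union>y\<in>H. U k y)" for k
  proof (rule less_outer_measure_of_UN_countable)
    show "countable (G k \<inter> D)"
      using \<open>countable D\<close> by blast
    show "U k y \<subseteq> space M" if "y \<in> G k \<inter> D" for y
      using U that by (blast dest: sets.sets_into_space)
    have "S k \<subseteq> (\<Union>y\<in>G k \<inter> D. U k y)"
    proof
      fix \<omega>
      assume "\<omega> \<in> S k"
      then show "\<omega> \<in> (\<Union>y\<in>G k \<inter> D. U k y)"
        using x[of \<omega> "G k" k] \<open>open (G k)\<close> xG[of k] S(1)[of k] by blast
    qed
    with S(2)[of k] show "c < outer_measure_of M (\<Union>y\<in>G k \<inter> D. U k y)"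
      by (meson less_le_trans outer_measure_of_mono)
  qed
  then obtain H where H: "\<And>k. H k \<subseteq> G k \<inter> D" "\<And>k. finite (H k)"
    and cH: "\<And>k. c < outer_measure_of M (\<Union>y\<in>H k. U k y)"
    by metis
  define B where "B = closure (\<Union>k. H k)"
  have "compact B"
    unfolding B_def
  proof (rule compact_closure_UN_finite)
    show "H k \<subseteq> (\<Union>q\<in>F j. ball q (1 / Suc j))" if "j < k" for j k
      using H(1)[of k] that by (auto simp: G_def)
  qed (fact H F)+
  define E where "E k = (\<Union>y\<in>H k. U k y)" for k
  have E: "E k \<in> sets M" for k
    unfolding E_def using H(1)[of k] H(2)[of k] U by (intro sets.finite_UN) auto
  \<comment> \<open>The intersection of the \<open>L n\<close> is the limsup of the
    \<open>E k\<close>. Continuity from above, valid for a finite measure, gives it measure at least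
    \<open>c\<close>, while \<open>avoid\<close> for \<open>B\<close> makes it null.\<close>
  define L where "L n = (\<Union>k\<in>{n..}. E k)" for n
  have L: "L n \<in> sets M" for n
    unfolding L_def using E by blast
  have "c \<le> emeasure M (L n)" for n
  proof -
    have "c \<le> emeasure M (E n)"
      using cH[of n] E[of n] by (simp flip: E_def)
    also have "\<dots> \<le> emeasure M (L n)"
      using L by (intro emeasure_mono) (auto simp: L_def)
    finally show ?thesis .
  qed
  then have "c \<le> (INF n. emeasure M (L n))"
    by (rule INF_greatest)
  also have "\<dots> = emeasure M (\<Inter>n. L n)"
    using L by (intro INF_emeasure_decseq) (force simp: L_def decseq_def)+
  also have "\<dots> = 0"
  proof -
    have "AE \<omega> in M. \<omega> \<notin> (\<Inter>n. L n)"
      using avoid[OF \<open>compact B\<close>]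
    proof eventually_elim
      case (elim \<omega>)
      then obtain n where n: "\<And>k y. k \<ge> n \<Longrightarrow> y \<in> B \<inter> D \<Longrightarrow> \<omega> \<notin> U k y"
        by (auto simp: eventually_sequentially)
      have "H k \<subseteq> B \<inter> D" for k
        using H(1)[of k] closure_subset[of "\<Union>k. H k"] by (auto simp: B_def)
      with n have "\<omega> \<notin> L n"
        unfolding L_def E_def by blast
      then show ?case by blast
    qed
    moreover have "(\<Inter>n. L n) \<in> sets M"
      using L by blast
    ultimately show ?thesis
      using AE_iff_measurable[of "\<Inter>n. L n" M "\<lambda>\<omega>. \<omega> \<notin> (\<Inter>n. L n)"] sets.sets_into_space[of "\<Inter>n. L n" M]
      by auto
  qed
  finally show False
    using \<open>0 < c\<close> by simp
qed

section \<open>Measurability and approximation of pullback distances\<close>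

text \<open>Measurability is given only at deterministic points. Since \<open>infdist\<close> is
  1-Lipschitz, its value at \<open>f \<omega>\<close> is an infimum over a countable dense set of
  expressions at such points.\<close>

lemma borel_measurable_infdist_random_set:
  fixes f :: "'w \<Rightarrow> 'x::polish_space"
  assumes f [measurable]: "f \<in> M \<rightarrow>\<^sub>M borel"
    and A [measurable]: "\<And>y. (\<lambda>\<omega>. infdist y (A \<omega>)) \<in> borel_measurable M"
  shows "(\<lambda>\<omega>. infdist (f \<omega>) (A \<omega>)) \<in> borel_measurable M"
proof -
  obtain D :: "'x set" where D: "countable D" "\<And>V. open V \<Longrightarrow> V \<noteq> {} \<Longrightarrow> \<exists>d\<in>D. d \<in> V"
    using countable_dense_setE by metis
  have "infdist z S < c \<longleftrightarrow> (\<exists>q\<in>D. dist z q + infdist q S < c)" for z :: 'x and S c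
  proof
    assume "infdist z S < c"
    \<comment> \<open>Half the slack, because \<open>dist z q\<close> is paid twice: once
      explicitly, once in comparing \<open>infdist q S\<close> with
      \<open>infdist z S\<close>.\<close>
    then have "z \<in> ball z ((c - infdist z S) / 2)"
      by simp
    then obtain q where q: "q \<in> D" "dist z q < (c - infdist z S) / 2"
      using D(2)[of "ball z ((c - infdist z S) / 2)"] by auto
    then show "\<exists>q\<in>D. dist z q + infdist q S < c"
      using infdist_triangle[of q S z] by (intro bexI[of _ q]) (auto simp: dist_commute field_simps)
  next
    assume "\<exists>q\<in>D. dist z q + infdist q S < c"
    then show "infdist z S < c"
      using infdist_triangle[of z S] by (smt (verit))
  qed
  then have "{\<omega> \<in> space M. infdist (f \<omega>) (A \<omega>) < c} =
      (\<Union>q\<in>D. {\<omega> \<in> space M. dist (f \<omega>) q + infdist q (A \<omega>) < c})" for c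
    by auto
  moreover have "(\<Union>q\<in>D. {\<omega> \<in> space M. dist (f \<omega>) q + infdist q (A \<omega>) < c}) \<in> sets M" for c
    using D(1) by (intro sets.countable_UN'') measurable
  ultimately show ?thesis
    by (simp add: borel_measurable_iff_less)
qed

context random_dynamical_system
begin

lemma flow_measurable_snd [measurable]: "\<theta> t \<in> P \<rightarrow>\<^sub>M P"
  using measurable_compose[OF measurable_Pair1'[of t borel P] flow_measurable] by simp

lemma pullback_measurable:
  assumes "0 \<le> t"
  shows "(\<lambda>\<omega>. \<phi> t (\<theta> (- t) \<omega>) x) \<in> P \<rightarrow>\<^sub>M borel"
proof -
  have "(\<lambda>\<omega>. (t, \<theta> (- t) \<omega>, x)) \<in> P \<rightarrow>\<^sub>M restrict_space borel {0..} \<Otimes>\<^sub>M (P \<Otimes>\<^sub>M borel)"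
    using assms by (intro measurable_Pair) (auto simp: space_restrict_space)
  from measurable_compose[OF this cocycle_measurable] show ?thesis
    by simp
qed

text \<open>Separate continuity suffices: first move \<open>x\<close> at the fixed time \<open>t\<close>, then move \<open>t\<close>.\<close>
lemma infdist_pullback_greater_dense:
  fixes D :: "'x set" and A :: "'x set"
  assumes pc: "pullback_continuous P \<theta> \<phi>"
    and D: "\<And>V. open V \<Longrightarrow> V \<noteq> {} \<Longrightarrow> \<exists>d\<in>D. d \<in> V"
    and "\<omega> \<in> space P" "open V" "x \<in> V" "0 \<le> k" "k < t"
    and less: "e < infdist (\<phi> t (\<theta> (- t) \<omega>) x) A"
  shows "\<exists>y\<in>V \<inter> D. \<exists>s\<in>\<rat>. k \<le> s \<and> e < infdist (\<phi> s (\<theta> (- s) \<omega>) y) A"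
proof -
  define W where "W = {y. e < infdist (\<phi> t (\<theta> (- t) \<omega>) y) A}"
  have "\<theta> (- t) \<omega> \<in> space P"
    using \<open>\<omega> \<in> space P\<close> by (rule measurable_space[OF flow_measurable_snd])
  then have "continuous_on UNIV (\<phi> t (\<theta> (- t) \<omega>))"
    using \<open>0 \<le> k\<close> \<open>k < t\<close> by (intro cocycle_continuous) auto
  then have "open W"
    unfolding W_def by (intro open_Collect_less continuous_on_const continuous_on_infdist)
  then obtain y where y: "y \<in> D" "y \<in> V" "y \<in> W"
    using D[of "V \<inter> W"] \<open>open V\<close> \<open>x \<in> V\<close> less unfolding W_def by blast
  define g where "g s = infdist (\<phi> s (\<theta> (- s) \<omega>) y) A" for s
  have "continuous_on {0..} g"
    unfolding g_def using pc \<open>\<omega> \<in> space P\<close>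
    by (intro continuous_on_infdist) (simp add: pullback_continuous_def)
  then have "continuous_on {k<..} g"
    using \<open>0 \<le> k\<close> by (auto elim: continuous_on_subset)
  \<comment> \<open>On the open half-line \<open>{k<..}\<close> the preimage is open in the real
    line itself, so rational times close to \<open>t\<close> are still later than
    \<open>k\<close>.\<close>
  then have "open ({k<..} \<inter> g -` {e<..})"
    by (intro continuous_open_preimage) auto
  moreover have "t \<in> {k<..} \<inter> g -` {e<..}"
    using y \<open>k < t\<close> by (auto simp: g_def W_def)
  ultimately obtain d where "0 < d" and d: "ball t d \<subseteq> {k<..} \<inter> g -` {e<..}"
    by (rule openE)
  obtain s where "s \<in> \<rat>" "t < s" "s < t + d"
    using Rats_dense_in_real[of t "t + d"] \<open>0 < d\<close> by auto
  then have "s \<in> ball t d"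
    by (simp add: dist_real_def)
  with d have "k \<le> s" "e < g s"
    by auto
  with y \<open>s \<in> \<rat>\<close> show ?thesis
    by (auto simp: g_def)
qed

section \<open>Failure of attraction at a fixed distance\<close>

lemma outer_measure_of_not_attracted:
  fixes A :: "'w \<Rightarrow> 'x set" and e :: real
  assumes pc: "pullback_continuous P \<theta> \<phi>" and attr: "pullback_attractor P \<theta> \<phi> A" and "0 < e"
  shows "outer_measure_of P {\<omega> \<in> space P. \<exists>K. compact K \<and>
      (\<exists>\<^sub>F t in at_top. \<exists>x\<in>K. e < infdist (\<phi> t (\<theta> (- t) \<omega>) x) (A \<omega>))} = 0"
    (is "outer_measure_of P ?N = 0")
proof -
  obtain D :: "'x set" where D: "countable D" "\<And>V. open V \<Longrightarrow> V \<noteq> {} \<Longrightarrow> \<exists>d\<in>D. d \<in> V"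
    using countable_dense_setE by metis
  \<comment> \<open>Restricting to rational times makes each event a countable union of measurable
    sets.\<close>
  define U where "U k y = {\<omega> \<in> space P. \<exists>s\<in>\<rat> \<inter> {real k..}.
      e < infdist (\<phi> s (\<theta> (- s) \<omega>) y) (A \<omega>)}" for k y
  have U: "U k y \<in> sets P" for k y
  proof -
    have "{\<omega> \<in> space P. e < infdist (\<phi> s (\<theta> (- s) \<omega>) y) (A \<omega>)} \<in> sets P"
      if "s \<in> \<rat> \<inter> {real k..}" for s
    proof -
      from that have "0 \<le> s" by auto
      moreover have "(\<lambda>\<omega>. infdist z (A \<omega>)) \<in> borel_measurable P" for z
        using attr by (simp add: pullback_attractor_def random_compact_set_def)
      ultimately have [measurable]:
        "(\<lambda>\<omega>. infdist (\<phi> s (\<theta> (- s) \<omega>) y) (A \<omega>)) \<in> borel_measurable P"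
        by (rule borel_measurable_infdist_random_set[OF pullback_measurable])
      show ?thesis by measurable
    qed
    moreover have "countable (\<rat> \<inter> {real k..})"
      using countable_rat by blast
    moreover have "U k y = (\<Union>s\<in>\<rat> \<inter> {real k..}.
        {\<omega> \<in> space P. e < infdist (\<phi> s (\<theta> (- s) \<omega>) y) (A \<omega>)})"
      by (auto simp: U_def)
    ultimately show ?thesis
      by (simp only:) (rule sets.countable_UN'')
  qed
  have avoid: "AE \<omega> in P. \<forall>\<^sub>F k in sequentially. \<forall>y\<in>B \<inter> D. \<omega> \<notin> U k y" if "compact B" for B
  proof -
    have "AE \<omega> in P. pullback_attracts_at \<theta> \<phi> A \<omega> B"
      using attr that by (auto simp: pullback_attractor_def)
    then show ?thesis
    proof eventually_elim
      case (elim \<omega>)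
      then have "\<forall>\<^sub>F t in at_top. (SUP x\<in>B. ennreal (infdist (\<phi> t (\<theta> (- t) \<omega>) x) (A \<omega>))) < ennreal e"
        unfolding pullback_attracts_at_def using \<open>0 < e\<close> by (intro order_tendstoD) auto
      then obtain T where T: "\<And>t. T \<le> t \<Longrightarrow>
          (SUP x\<in>B. ennreal (infdist (\<phi> t (\<theta> (- t) \<omega>) x) (A \<omega>))) < ennreal e"
        by (auto simp: eventually_at_top_linorder)
      have "infdist (\<phi> t (\<theta> (- t) \<omega>) y) (A \<omega>) \<le> e" if "T \<le> t" "y \<in> B" for t y
        using le_less_trans[OF SUP_upper[OF \<open>y \<in> B\<close>] T[OF \<open>T \<le> t\<close>]]
        by (simp add: ennreal_less_iff infdist_nonneg less_imp_le)
      then have "\<forall>y\<in>B \<inter> D. \<omega> \<notin> U k y" if "T \<le> real k" for k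
        using that by (auto simp: U_def not_less)
      then show ?case
        using eventually_ge_at_top[of "nat \<lceil>T\<rceil>"]
        by (auto elim!: eventually_mono)
    qed
  qed
  have "\<exists>x. \<forall>k V. open V \<longrightarrow> x \<in> V \<longrightarrow> (\<exists>y\<in>V \<inter> D. \<omega> \<in> U k y)" if "\<omega> \<in> ?N" for \<omega>
  proof -
    from that obtain K where \<omega>: "\<omega> \<in> space P" and "compact K"
      and K: "\<exists>\<^sub>F t in at_top. \<exists>x\<in>K. e < infdist (\<phi> t (\<theta> (- t) \<omega>) x) (A \<omega>)"
      by auto
    have "\<exists>t>real n. \<exists>x\<in>K. e < infdist (\<phi> t (\<theta> (- t) \<omega>) x) (A \<omega>)" for n
      using frequently_ex[OF frequently_eventually_frequently[OF K eventually_gt_at_top[of "real n"]]]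
      by blast
    then obtain t u where t: "\<And>n. real n < t n" and u: "\<And>n. u n \<in> K"
      and far: "\<And>n. e < infdist (\<phi> (t n) (\<theta> (- t n) \<omega>) (u n)) (A \<omega>)"
      by metis
    obtain x r where "strict_mono r" and lim: "(u \<circ> r) \<longlonglongrightarrow> x"
      using \<open>compact K\<close> u unfolding compact_def by metis
    have "\<exists>y\<in>V \<inter> D. \<omega> \<in> U k y" if "open V" "x \<in> V" for k V
    proof -
      have "\<forall>\<^sub>F n in sequentially. k \<le> n \<and> u (r n) \<in> V"
        using topological_tendstoD[OF lim that] eventually_ge_at_top[of k]
        by eventually_elim simp
      then obtain n where n: "k \<le> n" "u (r n) \<in> V"
        by (auto dest: eventually_happens)
      \<comment> \<open>A subsequence index satisfies \<open>n \<le> r n\<close>, whence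
        \<open>t (r n) > r n \<ge> n \<ge> k\<close>.\<close>
      have "real k < t (r n)"
        using n(1) seq_suble[OF \<open>strict_mono r\<close>, of n] t[of "r n"] by linarith
      from infdist_pullback_greater_dense[OF pc D(2) \<omega> \<open>open V\<close> n(2) _ this far]
      show ?thesis
        using \<omega> by (auto simp: U_def)
    qed
    then show ?thesis by blast
  qed
  then have "\<forall>\<omega>\<in>?N. \<exists>x. \<forall>k V. open V \<longrightarrow> x \<in> V \<longrightarrow> (\<exists>y\<in>V \<inter> D. \<omega> \<in> U k y)"
    by blast
  \<comment> \<open>The limit points are chosen separately for each \<open>\<omega>\<close>, with no
    control over measurability.\<close>
  from bchoice[OF this] obtain x where
    x: "\<forall>\<omega>\<in>?N. \<forall>k V. open V \<longrightarrow> x \<omega> \<in> V \<longrightarrow> (\<exists>y\<in>V \<inter> D. \<omega> \<in> U k y)"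
    by (rule exE)
  show ?thesis
  proof (rule outer_measure_of_eq_0_if_eventually_avoids_compact[OF D U avoid])
    show "\<exists>y\<in>V \<inter> D. \<omega> \<in> U k y" if "\<omega> \<in> ?N" "open V" "x \<omega> \<in> V" for \<omega> k V
      using x that by blast
  qed auto
qed

end

section \<open>One exceptional null set for all compact sets\<close>

theorem lemma3p1:
  fixes P :: "'w measure"
    and \<theta> :: "real \<Rightarrow> 'w \<Rightarrow> 'w"
    and \<phi> :: "real \<Rightarrow> 'w \<Rightarrow> 'x::polish_space \<Rightarrow> 'x"
    and A :: "'w \<Rightarrow> 'x set"
  assumes "random_dynamical_system P \<theta> \<phi>"
    and "pullback_continuous P \<theta> \<phi>"
    and "pullback_attractor P \<theta> \<phi> A"
  shows "\<exists>\<Omega>'\<in>sets P. emeasure P \<Omega>' = 1 \<and>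
    (\<forall>\<omega>\<in>\<Omega>'. \<forall>K. compact K \<longrightarrow>
      ((\<lambda>t. SUP x\<in>K. ennreal (infdist (\<phi> t (\<theta> (- t) \<omega>) x) (A \<omega>))) \<longlongrightarrow> 0) at_top)"
proof -
  interpret random_dynamical_system P \<theta> \<phi> by fact
  define N where "N n = {\<omega> \<in> space P. \<exists>K. compact K \<and>
      (\<exists>\<^sub>F t in at_top. \<exists>x\<in>K. 1 / Suc n < infdist (\<phi> t (\<theta> (- t) \<omega>) x) (A \<omega>))}" for n :: nat
  \<comment> \<open>\<open>N n\<close> quantifies over all compact sets and may fail to be
    measurable; its outer measure is attained by a measurable superset, which is therefore
    null.\<close>
  have "\<exists>E\<in>null_sets P. N n \<subseteq> E" for n
    using outer_measure_of_attain[of "N n" P]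
      outer_measure_of_not_attracted[OF assms(2,3), of "1 / Suc n"]
    by (force simp: N_def null_sets_def)
  then obtain E where E: "\<And>n. E n \<in> null_sets P" "\<And>n. N n \<subseteq> E n"
    by metis
  define \<Omega>' where "\<Omega>' = space P - (\<Union>n. E n)"
  have "(\<Union>n. E n) \<in> null_sets P"
    using E(1) by blast
  then have "\<Omega>' \<in> sets P" "emeasure P \<Omega>' = 1"
    by (auto simp: \<Omega>'_def emeasure_Diff_null_set emeasure_space_1)
  moreover have "((\<lambda>t. SUP x\<in>K. ennreal (infdist (\<phi> t (\<theta> (- t) \<omega>) x) (A \<omega>))) \<longlongrightarrow> 0) at_top"
    if "\<omega> \<in> \<Omega>'" "compact K" for \<omega> K
  proof (rule order_tendstoI)
    fix a :: ennreal
    assume "0 < a"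
    then obtain b where b: "0 < b" "b < a"
      using dense by blast
    obtain n where n: "ennreal (1 / Suc n) < b"
    proof -
      have "(\<lambda>n. ennreal (1 / Suc n)) \<longlonglongrightarrow> ennreal 0"
        by (intro tendsto_ennrealI LIMSEQ_Suc lim_1_over_n)
      then have "\<forall>\<^sub>F n in sequentially. ennreal (1 / Suc n) < b"
        using \<open>0 < b\<close> by (intro order_tendstoD) auto
      then show ?thesis
        using that by (auto dest: eventually_happens)
    qed
    have "\<omega> \<notin> N n"
      using that E(2) by (auto simp: \<Omega>'_def)
    then have "\<forall>\<^sub>F t in at_top. \<forall>x\<in>K. infdist (\<phi> t (\<theta> (- t) \<omega>) x) (A \<omega>) \<le> 1 / Suc n"
      using that by (auto simp: N_def \<Omega>'_def not_frequently not_less)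
    then show "\<forall>\<^sub>F t in at_top. (SUP x\<in>K. ennreal (infdist (\<phi> t (\<theta> (- t) \<omega>) x) (A \<omega>))) < a"
    proof eventually_elim
      case (elim t)
      \<comment> \<open>For empty \<open>K\<close> this holds because the supremum in
        \<open>ennreal\<close> is then 0.\<close>
      then have "(SUP x\<in>K. ennreal (infdist (\<phi> t (\<theta> (- t) \<omega>) x) (A \<omega>))) \<le> ennreal (1 / Suc n)"
        by (intro SUP_least ennreal_leI) auto
      with n b show ?case by order
    qed
  qed simp
  ultimately show ?thesis by blast
qed

end
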